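(* Let $(F_t,G_t,T_t)$, with $F_t=\sum_{i\ge0}F_it^i$, $G_t=\sum_{i\ge0}G_it^i$, $T_t=\sum_{i\ge0}T_it^i$, be a formal deformation of a Reynolds Lie-Yamaguti algebra $(L,T)$ of weight $\lambda$. Then $((F_1,G_1),T_1)$ is a 2-cocycle in the cochain complex $(\mathcal{C}^\bullet_{\mathrm{RLY}}(L),\mathrm{d}^\bullet)$, i.e. $\mathrm{d}^2((F_1,G_1),T_1)=0$.
   Context: All vector spaces are over an algebraically closed field $\mathbb{K}$ of characteristic zero, and $\lambda\in\mathbb{K}$. A Lie-Yamaguti algebra is a vector space $L$ with a bilinear bracket $[-,-]$ and a trilinear bracket $\{-,-,-\}$ such that for all $x,y,z,a,b\in L$ (with $\circlearrowleft_{x,y,z}$ the sum over cyclic permutations of $x,y,z$): (LY1) $[x,y]=-[y,x]$; (LY2) $\{x,y,z\}=-\{y,x,z\}$; (LY3) $\circlearrowleft_{x,y,z}[[x,y],z]+\circlearrowleft_{x,y,z}\{x,y,z\}=0$; (LY4) $\circlearrowleft_{x,y,z}\{[x,y],z,a\}=0$; (LY5) $\{a,b,[x,y]\}=[\{a,b,x\},y]+[x,\{a,b,y\}]$; (LY6) $\{a,b,\{x,y,z\}\}=\{\{a,b,x\},y,z\}+\{x,\{a,b,y\},z\}+\{x,y,\{a,b,z\}\}$. The same definition is used over the ring $\mathbb{K}[[t]]$. A Reynolds Lie-Yamaguti algebra $(L,T)$ of weight $\lambda$ is a Lie-Yamaguti algebra $L$ with a linear map $T:L\to L$ satisfying $[Tx,Ty]=T([Tx,y]+[x,Ty]+\lambda[Tx,Ty])$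 and $\{Tx,Ty,Tz\}=T(\{x,Ty,Tz\}+\{Tx,y,Tz\}+\{Tx,Ty,z\}+2\lambda\{Tx,Ty,Tz\})$. Complex with adjoint coefficients in low degrees. Put $\rho(x)u=[x,u]$, $\theta(x,y)u=\{u,x,y\}$, $D(x,y)u=\{x,y,u\}$ on $V=L$, $T_V=T$. Set $\mathcal{C}^1_{\mathrm{RLY}}(L)=\mathrm{Hom}(L,L)$ and $\mathcal{C}^2_{\mathrm{RLY}}(L)=\big(\mathrm{Hom}(\wedge^2L,L)\times\mathrm{Hom}(\wedge^2L\otimes L,L)\big)\oplus\mathrm{Hom}(L,L)$. The differentials are $\mathrm{d}^1(f)=(\delta^1f,-\Phi^1f)$ and $\mathrm{d}^2((f,g),h)=(\delta^2(f,g),-\partial^1h-\Phi^2(f,g))$, where each of $\delta^i,\partial^1,\Phi^2$ has two components $I,II$: $\delta^1_I(f)(x,y)=\rho(x)f(y)-\rho(y)f(x)-f([x,y])$; $\delta^1_{II}(f)(x,y,z)=D(x,y)f(z)+\theta(y,z)f(x)-\theta(x,z)f(y)-f(\{x,y,z\})$; $\Phi^1(f)=f\circ T-T_V\circ f$. $\delta^2_I(f,g)(x_1,y_1,x_2,y_2)=-\rho(x_2)g(x_1,y_1,y_2)+\rho(y_2)g(x_1,y_1,x_2)+g(x_1,y_1,[x_2,y_2])+D(x_1,y_1)f(x_2,y_2)-f(\{x_1,y_1,x_2\},y_2)-f(x_2,\{x_1,y_1,y_2\})$; $\delta^2_{II}(f,g)(x_1,y_1,x_2,y_2,z)=-\theta(y_2,z)g(x_1,y_1,x_2)+\theta(x_2,z)g(x_1,y_1,y_2)+D(x_1,y_1)g(x_2,y_2,z)-D(x_2,y_2)g(x_1,y_1,z)-g(\{x_1,y_1,x_2\},y_2,z)-g(x_2,\{x_1,y_1,y_2\},z)-g(x_2,y_2,\{x_1,y_1,z\})+g(x_1,y_1,\{x_2,y_2,z\})$;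 $\Phi^2_I(f)(x,y)=f(Tx,Ty)-T_V\big(f(x,Ty)+f(Tx,y)+\lambda f(Tx,Ty)\big)$; $\Phi^2_{II}(g)(x,y,z)=g(Tx,Ty,Tz)-T_V\big(g(x,Ty,Tz)+g(Tx,y,Tz)+g(Tx,Ty,z)+2\lambda g(Tx,Ty,Tz)\big)$; $\partial^1_I(h)(x,y)=\rho_T(x)h(y)-\rho_T(y)h(x)-h([x,y]_T)$; $\partial^1_{II}(h)(x,y,z)=D_T(x,y)h(z)+\theta_T(y,z)h(x)-\theta_T(x,z)h(y)-h(\{x,y,z\}_T)$; with $[x,y]_T=[Tx,y]+[x,Ty]+\lambda[Tx,Ty]$, $\{x,y,z\}_T=\{x,Ty,Tz\}+\{Tx,y,Tz\}+\{Tx,Ty,z\}+2\lambda\{Tx,Ty,Tz\}$, $\rho_T(x)u=\rho(Tx)u-T_V(\lambda\rho(Tx)u+\rho(x)u)$, $\theta_T(x,y)u=\theta(Tx,Ty)u-T_V(2\lambda\theta(Tx,Ty)u+\theta(Tx,y)u+\theta(x,Ty)u)$, $D_T(x,y)u=D(Tx,Ty)u-T_V(2\lambda D(Tx,Ty)u+D(x,Ty)u+D(Tx,y)u)$. A formal deformation of $(L,T)$ is a triple $(F_t,G_t,T_t)$ of power series $F_t=\sum_{i\ge0}F_it^i$, $G_t=\sum_{i\ge0}G_it^i$, $T_t=\sum_{i\ge0}T_it^i$ with $((F_i,G_i),T_i)\in\mathcal{C}^2_{\mathrm{RLY}}(L)$ for all $i$, $F_0=[-,-]$, $G_0=\{-,-,-\}$,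 $T_0=T$, such that $(L[[t]],F_t,G_t,T_t)$ (maps extended $\mathbb{K}[[t]]$-multilinearly) is a Reynolds Lie-Yamaguti algebra of weight $\lambda$ over $\mathbb{K}[[t]]$. *)

theory Defs
  imports
    "HOL-Computational_Algebra.Polynomial"
    "HOL-Computational_Algebra.Formal_Power_Series"
    "HOL-Library.Function_Algebras"
    "HOL-Library.Product_Plus"
begin

section \<open>Lie-Yamaguti algebras and Reynolds operators\<close>

text \<open>
  Scalars range over a commutative ring, so that the same notions apply over a field and over its
  ring of formal power series.  Over a field, the locale \<^locale>\<open>module\<close> is the notion of a
  vector space.
\<close>

definition bilinear_map ::
  "('k::comm_ring_1 \<Rightarrow> 'v::ab_group_add \<Rightarrow> 'v) \<Rightarrow> ('v \<Rightarrow> 'v \<Rightarrow> 'v) \<Rightarrow> bool"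
  where "bilinear_map s f \<longleftrightarrow>
    (\<forall>y. module_hom s s (\<lambda>x. f x y)) \<and> (\<forall>x. module_hom s s (\<lambda>y. f x y))"

definition trilinear_map ::
  "('k::comm_ring_1 \<Rightarrow> 'v::ab_group_add \<Rightarrow> 'v) \<Rightarrow> ('v \<Rightarrow> 'v \<Rightarrow> 'v \<Rightarrow> 'v) \<Rightarrow> bool"
  where "trilinear_map s g \<longleftrightarrow>
    (\<forall>y z. module_hom s s (\<lambda>x. g x y z)) \<and>
    (\<forall>x z. module_hom s s (\<lambda>y. g x y z)) \<and>
    (\<forall>x y. module_hom s s (\<lambda>z. g x y z))"

locale lie_yamaguti = module scale
  for scale :: "'k::comm_ring_1 \<Rightarrow> 'v::ab_group_add \<Rightarrow> 'v" (infixr "*s" 75) +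
  fixes br :: "'v \<Rightarrow> 'v \<Rightarrow> 'v"
    and tr :: "'v \<Rightarrow> 'v \<Rightarrow> 'v \<Rightarrow> 'v"
  assumes br_bilinear: "bilinear_map scale br"
    and tr_trilinear: "trilinear_map scale tr"
    and LY1: "br x y = - br y x"
    and LY2: "tr x y z = - tr y x z"
    and LY3: "(br (br x y) z + br (br y z) x + br (br z x) y)
              + (tr x y z + tr y z x + tr z x y) = 0"
    and LY4: "tr (br x y) z a + tr (br y z) x a + tr (br z x) y a = 0"
    and LY5: "tr a b (br x y) = br (tr a b x) y + br x (tr a b y)"
    and LY6: "tr a b (tr x y z) = tr (tr a b x) y z + tr x (tr a b y) z + tr x y (tr a b z)"

locale reynolds_lie_yamaguti = lie_yamaguti scale br tr
  for scale :: "'k::comm_ring_1 \<Rightarrow> 'v::ab_group_add \<Rightarrow> 'v" (infixr "*s" 75)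
    and br :: "'v \<Rightarrow> 'v \<Rightarrow> 'v"
    and tr :: "'v \<Rightarrow> 'v \<Rightarrow> 'v \<Rightarrow> 'v" +
  fixes T :: "'v \<Rightarrow> 'v"
    and lam :: 'k
  assumes T_linear: "module_hom scale scale T"
    and reynolds_br: "br (T x) (T y) = T (br (T x) y + br x (T y) + lam *s br (T x) (T y))"
    and reynolds_tr: "tr (T x) (T y) (T z) =
      T (tr x (T y) (T z) + tr (T x) y (T z) + tr (T x) (T y) z
         + (2 * lam) *s tr (T x) (T y) (T z))"


section \<open>The complex with adjoint coefficients in degree two\<close>

text \<open>
  An element of \<open>Hom(\<and>\<^sup>2L, L)\<close> is an alternating bilinear map, an element of
  \<open>Hom(\<and>\<^sup>2L \<otimes> L, L)\<close> a trilinear map that is alternating in its first two arguments.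
\<close>

definition Hom_wedge2 ::
  "('k::comm_ring_1 \<Rightarrow> 'v::ab_group_add \<Rightarrow> 'v) \<Rightarrow> ('v \<Rightarrow> 'v \<Rightarrow> 'v) set"
  where "Hom_wedge2 s = {f. bilinear_map s f \<and> (\<forall>x. f x x = 0)}"

definition Hom_wedge2_tensor ::
  "('k::comm_ring_1 \<Rightarrow> 'v::ab_group_add \<Rightarrow> 'v) \<Rightarrow> ('v \<Rightarrow> 'v \<Rightarrow> 'v \<Rightarrow> 'v) set"
  where "Hom_wedge2_tensor s = {g. trilinear_map s g \<and> (\<forall>x z. g x x z = 0)}"

definition C2_RLY ::
  "('k::comm_ring_1 \<Rightarrow> 'v::ab_group_add \<Rightarrow> 'v) \<Rightarrow>
   ((('v \<Rightarrow> 'v \<Rightarrow> 'v) \<times> ('v \<Rightarrow> 'v \<Rightarrow> 'v \<Rightarrow> 'v)) \<times> ('v \<Rightarrow> 'v)) set"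
  where "C2_RLY s = (Hom_wedge2 s \<times> Hom_wedge2_tensor s) \<times> {h. module_hom s s h}"

context reynolds_lie_yamaguti
begin

definition rho :: "'v \<Rightarrow> 'v \<Rightarrow> 'v"
  where "rho x u = br x u"

definition theta :: "'v \<Rightarrow> 'v \<Rightarrow> 'v \<Rightarrow> 'v"
  where "theta x y u = tr u x y"

definition D :: "'v \<Rightarrow> 'v \<Rightarrow> 'v \<Rightarrow> 'v"
  where "D x y u = tr x y u"

definition br_T :: "'v \<Rightarrow> 'v \<Rightarrow> 'v"
  where "br_T x y = br (T x) y + br x (T y) + lam *s br (T x) (T y)"

definition tr_T :: "'v \<Rightarrow> 'v \<Rightarrow> 'v \<Rightarrow> 'v"
  where "tr_T x y z = tr x (T y) (T z) + tr (T x) y (T z) + tr (T x) (T y) z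
    + (2 * lam) *s tr (T x) (T y) (T z)"

definition rho_T :: "'v \<Rightarrow> 'v \<Rightarrow> 'v"
  where "rho_T x u = rho (T x) u - T (lam *s rho (T x) u + rho x u)"

definition theta_T :: "'v \<Rightarrow> 'v \<Rightarrow> 'v \<Rightarrow> 'v"
  where "theta_T x y u = theta (T x) (T y) u
    - T ((2 * lam) *s theta (T x) (T y) u + theta (T x) y u + theta x (T y) u)"

definition D_T :: "'v \<Rightarrow> 'v \<Rightarrow> 'v \<Rightarrow> 'v"
  where "D_T x y u = D (T x) (T y) u
    - T ((2 * lam) *s D (T x) (T y) u + D x (T y) u + D (T x) y u)"

definition delta2_I ::
  "('v \<Rightarrow> 'v \<Rightarrow> 'v) \<Rightarrow> ('v \<Rightarrow> 'v \<Rightarrow> 'v \<Rightarrow> 'v) \<Rightarrow> 'v \<Rightarrow> 'v \<Rightarrow> 'v \<Rightarrow> 'v \<Rightarrow> 'v"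
  where "delta2_I f g x1 y1 x2 y2 =
    - rho x2 (g x1 y1 y2) + rho y2 (g x1 y1 x2) + g x1 y1 (br x2 y2)
    + D x1 y1 (f x2 y2) - f (tr x1 y1 x2) y2 - f x2 (tr x1 y1 y2)"

definition delta2_II ::
  "('v \<Rightarrow> 'v \<Rightarrow> 'v) \<Rightarrow> ('v \<Rightarrow> 'v \<Rightarrow> 'v \<Rightarrow> 'v) \<Rightarrow> 'v \<Rightarrow> 'v \<Rightarrow> 'v \<Rightarrow> 'v \<Rightarrow> 'v \<Rightarrow> 'v"
  where "delta2_II f g x1 y1 x2 y2 z =
    - theta y2 z (g x1 y1 x2) + theta x2 z (g x1 y1 y2)
    + D x1 y1 (g x2 y2 z) - D x2 y2 (g x1 y1 z)
    - g (tr x1 y1 x2) y2 z - g x2 (tr x1 y1 y2) z - g x2 y2 (tr x1 y1 z)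
    + g x1 y1 (tr x2 y2 z)"

definition Phi2_I :: "('v \<Rightarrow> 'v \<Rightarrow> 'v) \<Rightarrow> 'v \<Rightarrow> 'v \<Rightarrow> 'v"
  where "Phi2_I f x y = f (T x) (T y) - T (f x (T y) + f (T x) y + lam *s f (T x) (T y))"

definition Phi2_II :: "('v \<Rightarrow> 'v \<Rightarrow> 'v \<Rightarrow> 'v) \<Rightarrow> 'v \<Rightarrow> 'v \<Rightarrow> 'v \<Rightarrow> 'v"
  where "Phi2_II g x y z = g (T x) (T y) (T z)
    - T (g x (T y) (T z) + g (T x) y (T z) + g (T x) (T y) z
         + (2 * lam) *s g (T x) (T y) (T z))"

definition partial1_I :: "('v \<Rightarrow> 'v) \<Rightarrow> 'v \<Rightarrow> 'v \<Rightarrow> 'v"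
  where "partial1_I h x y = rho_T x (h y) - rho_T y (h x) - h (br_T x y)"

definition partial1_II :: "('v \<Rightarrow> 'v) \<Rightarrow> 'v \<Rightarrow> 'v \<Rightarrow> 'v \<Rightarrow> 'v"
  where "partial1_II h x y z =
    D_T x y (h z) + theta_T y z (h x) - theta_T x z (h y) - h (tr_T x y z)"

definition delta2 ::
  "('v \<Rightarrow> 'v \<Rightarrow> 'v) \<times> ('v \<Rightarrow> 'v \<Rightarrow> 'v \<Rightarrow> 'v) \<Rightarrow>
   ('v \<Rightarrow> 'v \<Rightarrow> 'v \<Rightarrow> 'v \<Rightarrow> 'v) \<times> ('v \<Rightarrow> 'v \<Rightarrow> 'v \<Rightarrow> 'v \<Rightarrow> 'v \<Rightarrow> 'v)"
  where "delta2 = (\<lambda>(f, g). (delta2_I f g, delta2_II f g))"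

definition Phi2 ::
  "('v \<Rightarrow> 'v \<Rightarrow> 'v) \<times> ('v \<Rightarrow> 'v \<Rightarrow> 'v \<Rightarrow> 'v) \<Rightarrow> ('v \<Rightarrow> 'v \<Rightarrow> 'v) \<times> ('v \<Rightarrow> 'v \<Rightarrow> 'v \<Rightarrow> 'v)"
  where "Phi2 = (\<lambda>(f, g). (Phi2_I f, Phi2_II g))"

definition partial1 :: "('v \<Rightarrow> 'v) \<Rightarrow> ('v \<Rightarrow> 'v \<Rightarrow> 'v) \<times> ('v \<Rightarrow> 'v \<Rightarrow> 'v \<Rightarrow> 'v)"
  where "partial1 h = (partial1_I h, partial1_II h)"

text \<open>The additive structure on cochains is the pointwise and componentwise one.\<close>

definition d2 ::
  "(('v \<Rightarrow> 'v \<Rightarrow> 'v) \<times> ('v \<Rightarrow> 'v \<Rightarrow> 'v \<Rightarrow> 'v)) \<times> ('v \<Rightarrow> 'v) \<Rightarrow>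
   (('v \<Rightarrow> 'v \<Rightarrow> 'v \<Rightarrow> 'v \<Rightarrow> 'v) \<times> ('v \<Rightarrow> 'v \<Rightarrow> 'v \<Rightarrow> 'v \<Rightarrow> 'v \<Rightarrow> 'v)) \<times> (('v \<Rightarrow> 'v \<Rightarrow> 'v) \<times> ('v \<Rightarrow> 'v \<Rightarrow> 'v \<Rightarrow> 'v))"
  where "d2 = (\<lambda>(fg, h). (delta2 fg, - partial1 h - Phi2 fg))"

definition Z2_RLY :: "((('v \<Rightarrow> 'v \<Rightarrow> 'v) \<times> ('v \<Rightarrow> 'v \<Rightarrow> 'v \<Rightarrow> 'v)) \<times> ('v \<Rightarrow> 'v)) set"
  where "Z2_RLY = {c \<in> C2_RLY scale. d2 c = 0}"

end


section \<open>Formal deformations\<close>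

text \<open>
  \<open>L[[t]]\<close> is the type \<^typ>\<open>'v fps\<close>.  A series of multilinear maps on \<open>L\<close>, given by its
  sequence of coefficients, is extended to \<open>L[[t]]\<close> by the Cauchy product.
\<close>

definition fps_scale ::
  "('k::comm_ring_1 \<Rightarrow> 'v::ab_group_add \<Rightarrow> 'v) \<Rightarrow> 'k fps \<Rightarrow> 'v fps \<Rightarrow> 'v fps"
  where "fps_scale s c x = Abs_fps (\<lambda>n. \<Sum>i\<le>n. s (fps_nth c i) (fps_nth x (n - i)))"

definition fps_ext1 :: "(nat \<Rightarrow> 'v::ab_group_add \<Rightarrow> 'v) \<Rightarrow> 'v fps \<Rightarrow> 'v fps"
  where "fps_ext1 h x = Abs_fps (\<lambda>n. \<Sum>i\<le>n. h i (fps_nth x (n - i)))"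

definition fps_ext2 ::
  "(nat \<Rightarrow> 'v::ab_group_add \<Rightarrow> 'v \<Rightarrow> 'v) \<Rightarrow> 'v fps \<Rightarrow> 'v fps \<Rightarrow> 'v fps"
  where "fps_ext2 f x y = Abs_fps (\<lambda>n. \<Sum>i\<le>n. \<Sum>j\<le>n - i.
    f i (fps_nth x j) (fps_nth y (n - i - j)))"

definition fps_ext3 ::
  "(nat \<Rightarrow> 'v::ab_group_add \<Rightarrow> 'v \<Rightarrow> 'v \<Rightarrow> 'v) \<Rightarrow> 'v fps \<Rightarrow> 'v fps \<Rightarrow> 'v fps \<Rightarrow> 'v fps"
  where "fps_ext3 g x y z = Abs_fps (\<lambda>n. \<Sum>i\<le>n. \<Sum>j\<le>n - i. \<Sum>k\<le>n - i - j.
    g i (fps_nth x j) (fps_nth y k) (fps_nth z (n - i - j - k)))"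

definition (in reynolds_lie_yamaguti) formal_deformation ::
  "(nat \<Rightarrow> 'v \<Rightarrow> 'v \<Rightarrow> 'v) \<Rightarrow> (nat \<Rightarrow> 'v \<Rightarrow> 'v \<Rightarrow> 'v \<Rightarrow> 'v) \<Rightarrow> (nat \<Rightarrow> 'v \<Rightarrow> 'v) \<Rightarrow> bool"
  where "formal_deformation Ft Gt Tt \<longleftrightarrow>
    (\<forall>i. ((Ft i, Gt i), Tt i) \<in> C2_RLY scale) \<and>
    Ft 0 = br \<and> Gt 0 = tr \<and> Tt 0 = T \<and>
    reynolds_lie_yamaguti (fps_scale scale) (fps_ext2 Ft) (fps_ext3 Gt) (fps_ext1 Tt)
      (fps_const lam)"

end

theory Submission
  imports Defs
begin

text \<open>
  Each identity \<open>\<delta>\<^sup>2\<^sub>I = 0\<close>, \<open>\<delta>\<^sup>2\<^sub>I\<^sub>I = 0\<close>, \<open>\<partial>\<^sup>1\<^sub>I + \<Phi>\<^sup>2\<^sub>I = 0\<close>, \<open>\<partial>\<^sup>1\<^sub>I\<^sub>I + \<Phi>\<^sup>2\<^sub>I\<^sub>I = 0\<close> is,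
  up to skew-symmetry of the undeformed brackets, the coefficient of \<open>t\<close> in (LY5), (LY6) and the
  two Reynolds identities of the deformed structure, evaluated at constant series.
\<close>

lemma fps_ext1_nth_0: "fps_nth (fps_ext1 h x) 0 = h 0 (fps_nth x 0)"
  by (simp add: fps_ext1_def)

text \<open>A Leibniz pattern, shared by the two- and three-argument versions: the single factor t
  comes either from the map or from exactly one argument.\<close>

lemma fps_ext1_nth_1:
  "fps_nth (fps_ext1 h x) (Suc 0) = h 0 (fps_nth x 1) + h 1 (fps_nth x 0)"
  by (simp add: fps_ext1_def)

lemma fps_ext2_nth_0: "fps_nth (fps_ext2 f x y) 0 = f 0 (fps_nth x 0) (fps_nth y 0)"
  by (simp add: fps_ext2_def)

lemma fps_ext2_nth_1:
  "fps_nth (fps_ext2 f x y) (Suc 0) =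
    f 0 (fps_nth x 0) (fps_nth y 1) + f 0 (fps_nth x 1) (fps_nth y 0)
    + f 1 (fps_nth x 0) (fps_nth y 0)"
  by (simp add: fps_ext2_def)

lemma fps_ext3_nth_0:
  "fps_nth (fps_ext3 g x y z) 0 = g 0 (fps_nth x 0) (fps_nth y 0) (fps_nth z 0)"
  by (simp add: fps_ext3_def)

lemma fps_ext3_nth_1:
  "fps_nth (fps_ext3 g x y z) (Suc 0) =
    g 0 (fps_nth x 0) (fps_nth y 0) (fps_nth z 1) + g 0 (fps_nth x 0) (fps_nth y 1) (fps_nth z 0)
    + g 0 (fps_nth x 1) (fps_nth y 0) (fps_nth z 0) + g 1 (fps_nth x 0) (fps_nth y 0) (fps_nth z 0)"
  by (simp add: fps_ext3_def)

text \<open>The deformed algebra has the constant series \<open>fps_const lam\<close> as its weight,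
  so only the term \<open>i = 0\<close> of the Cauchy product survives.\<close>

lemma (in module) fps_scale_const_nth:
  "fps_nth (fps_scale scale (fps_const c) x) n = scale c (fps_nth x n)"
proof -
  have "fps_nth (fps_scale scale (fps_const c) x) n =
      (\<Sum>i\<le>n. if i = 0 then scale c (fps_nth x n) else 0)"
    unfolding fps_scale_def fps_nth_Abs_fps by (rule sum.cong) auto
  then show ?thesis by simp
qed

lemmas fps_low_coeffs =
  fps_ext1_nth_0 fps_ext1_nth_1 fps_ext2_nth_0 fps_ext2_nth_1 fps_ext3_nth_0 fps_ext3_nth_1

lemma bilinear_mapD:
  assumes "bilinear_map s f"
  shows "module_hom s s (\<lambda>x. f x y)" "module_hom s s (f x)"
  using assms unfolding bilinear_map_def by blast+

lemma trilinear_mapD: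
  assumes "trilinear_map s g"
  shows "module_hom s s (\<lambda>x. g x y z)" "module_hom s s (\<lambda>y. g x y z)" "module_hom s s (g x y)"
  using assms unfolding trilinear_map_def by blast+

context reynolds_lie_yamaguti
begin

lemma formal_deformation_infinitesimal_cocycle:
  assumes "formal_deformation Ft Gt Tt"
  shows "((Ft 1, Gt 1), Tt 1) \<in> Z2_RLY"
proof -
  let ?F = "Ft (Suc 0)" and ?G = "Gt (Suc 0)" and ?H = "Tt (Suc 0)"
  have cochain: "((?F, ?G), ?H) \<in> C2_RLY scale" and init: "Ft 0 = br" "Gt 0 = tr" "Tt 0 = T"
    using assms by (auto simp: formal_deformation_def)
  interpret def: reynolds_lie_yamaguti "fps_scale scale" "fps_ext2 Ft" "fps_ext3 Gt" "fps_ext1 Tt"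
    "fps_const lam"
    using assms by (simp add: formal_deformation_def)
  have lin: "bilinear_map scale ?F" "trilinear_map scale ?G" "module_hom scale scale ?H"
    using cochain by (auto simp: C2_RLY_def Hom_wedge2_def Hom_wedge2_tensor_def)
  note homs = bilinear_mapD[OF br_bilinear] trilinear_mapD[OF tr_trilinear] T_linear
    bilinear_mapD[OF lin(1)] trilinear_mapD[OF lin(2)] lin(3)
  \<comment> \<open>Constant series have zero coefficient at t; these rules remove the terms where a
    map meets that zero.\<close>
  note zero = homs[THEN module_hom.zero]
  \<comment> \<open>The Reynolds identity puts all terms under one \<open>T\<close>, whereas
    \<open>rho_T\<close>, \<open>theta_T\<close>, \<open>D_T\<close> and \<open>Phi2\<close>
    distribute them over several; splitting \<open>T\<close> over sums makes the two sides
    comparable.\<close>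
  note T_additive = T_linear[THEN module_hom.add] T_linear[THEN module_hom.diff]
    T_linear[THEN module_hom.neg]
  note coeffs = fps_low_coeffs fps_scale_const_nth init zero
  \<comment> \<open>Here (LY5) yields \<open>br (?G a b x) y\<close>, while \<open>rho\<close> acts
    from the left and gives \<open>br y (?G a b x)\<close>; hence the instance of
    \<open>LY1\<close>.\<close>
  have cLY5: "delta2_I ?F ?G a b x y = 0" for a b x y
    using arg_cong[OF def.LY5[of "fps_const a" "fps_const b" "fps_const x" "fps_const y"],
        of "\<lambda>s. fps_nth s 1"] LY1[of y "?G a b x"]
    by (simp add: coeffs delta2_I_def rho_def D_def algebra_simps)
  have cLY6: "delta2_II ?F ?G a b x y z = 0" for a b x y z
    using arg_cong[OF def.LY6[of "fps_const a" "fps_const b" "fps_const x" "fps_const y"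
          "fps_const z"], of "\<lambda>s. fps_nth s 1"] LY2[of "?G a b y" x z]
    by (simp add: coeffs delta2_II_def theta_def D_def algebra_simps)
  \<comment> \<open>Terms with \<open>?H\<close> on one argument form the two \<open>rho_T\<close>
    terms, those with \<open>?H\<close> outermost form \<open>?H (br_T x y)\<close>, and those with
    \<open>?F\<close> form \<open>Phi2_I\<close>.\<close>
  have cR2: "partial1_I ?H x y + Phi2_I ?F x y = 0" for x y
    using arg_cong[OF def.reynolds_br[of "fps_const x" "fps_const y"], of "\<lambda>s. fps_nth s 1"]
    by (simp add: coeffs partial1_I_def Phi2_I_def rho_T_def rho_def br_T_def
        LY1[of "T y" "?H x"] LY1[of y "?H x"] T_additive algebra_simps)
  \<comment> \<open>Exhibits the coefficient in the ternary identity as a constant series, so that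
    scaling by it is coefficientwise.\<close>
  have two_lam: "2 * fps_const lam = fps_const (2 * lam)"
    by (metis fps_const_mult fps_numeral_fps_const)
  \<comment> \<open>The same sorting as in the binary case; \<open>LY2\<close> moves
    \<open>?H y\<close> from the second slot to the first, where \<open>theta_T x z\<close> expects
    it.\<close>
  have cR3: "partial1_II ?H x y z + Phi2_II ?G x y z = 0" for x y z
    using arg_cong[OF def.reynolds_tr[of "fps_const x" "fps_const y" "fps_const z"],
        of "\<lambda>s. fps_nth s 1", unfolded two_lam]
    by (simp add: coeffs partial1_II_def Phi2_II_def theta_T_def theta_def D_T_def D_def tr_T_def
        LY2[of "?H y" x] LY2[of "?H y" "T x"] T_additive algebra_simps)
  have "delta2_I ?F ?G = 0" "delta2_II ?F ?G = 0"
    using cLY5 cLY6 by (simp_all add: fun_eq_iff)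
  moreover have "- partial1_I ?H - Phi2_I ?F = 0" "- partial1_II ?H - Phi2_II ?G = 0"
    using cR2 cR3 by (simp_all add: fun_eq_iff neg_eq_iff_add_eq_0)
  ultimately have "d2 ((?F, ?G), ?H) = 0"
    by (simp add: d2_def delta2_def Phi2_def partial1_def zero_prod_def)
  with cochain show ?thesis
    by (simp add: Z2_RLY_def)
qed

end

theorem proposition5p2:
  fixes scale :: "'k::{alg_closed_field, field_char_0} \<Rightarrow> 'v::ab_group_add \<Rightarrow> 'v"
    and br :: "'v \<Rightarrow> 'v \<Rightarrow> 'v"
    and tr :: "'v \<Rightarrow> 'v \<Rightarrow> 'v \<Rightarrow> 'v"
    and T :: "'v \<Rightarrow> 'v"
    and lam :: 'k
    and Ft :: "nat \<Rightarrow> 'v \<Rightarrow> 'v \<Rightarrow> 'v"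
    and Gt :: "nat \<Rightarrow> 'v \<Rightarrow> 'v \<Rightarrow> 'v \<Rightarrow> 'v"
    and Tt :: "nat \<Rightarrow> 'v \<Rightarrow> 'v"
  assumes "reynolds_lie_yamaguti scale br tr T lam"
    and "reynolds_lie_yamaguti.formal_deformation scale br tr T lam Ft Gt Tt"
  shows "((Ft 1, Gt 1), Tt 1) \<in> reynolds_lie_yamaguti.Z2_RLY scale br tr T lam"
  using assms by (rule reynolds_lie_yamaguti.formal_deformation_infinitesimal_cocycle)

end
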